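(* Let $G$ be a super edge-magic graph that contains a cycle, with $|E(G)| = 2|V(G)|-5$ and girth $g(G)\ge 5$. Then $|\sigma_G| = 1$, where $\sigma_G$ is the super edge-magic set of $G$.
   Context: Graphs are finite and simple. The notation $[a,b]$ denotes the set of integers $x$ with $a\le x\le b$. An edge-magic labeling of a graph $G$ is a bijection $f:V(G)\cup E(G)\to[1,|V(G)|+|E(G)|]$ such that $f(u)+f(v)+f(uv)$ equals a constant (the valence $\mathrm{val}(f)$ of $f$) for every $uv\in E(G)$. It is super edge-magic if moreover $f(V(G))=[1,|V(G)|]$, and $G$ is super edge-magic if it admits a super edge-magic labeling. For a graph $G$ of order $p$ and size $q$ (with $q\geq 1$), let $$S_G=\left\{\frac{\sum_{u\in V(G)}\deg(u)g(u)+\sum_{i=p+1}^{p+q} i}{q} : g:V(G)\to[1,p]\text{ bijective}\right\}.$$ If $\lceil\min S_G\rceil\le\lfloor\max S_G\rfloor$, the super edge-magic interval of $G$ is $I_G=[\lceil\min S_G\rceil,\lfloor\max S_G\rfloor]$. The super edge-magic set of $G$ is $$\sigma_G=\{k\in I_G : \text{there exists a super edge-magic labeling of } G\text{ with valence } k\}.$$ The girth of a graph that contains a cycle is the length of its shortest cycle; it is defined only for graphs containing a cycle. *)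

theory Defs
  imports Complex_Main
begin

text \<open>A finite simple graph is given by its vertex set \<open>V\<close> and its edge set \<open>E\<close>, whose members
  are two-element subsets of \<open>V\<close>.\<close>

locale finite_simple_graph =
  fixes V :: "'a set" and E :: "'a set set"
  assumes finite_V: "finite V"
    and edges: "\<And>e. e \<in> E \<Longrightarrow> e \<subseteq> V \<and> card e = 2"

definition degree :: "'a set set \<Rightarrow> 'a \<Rightarrow> nat" where
  "degree E u = card {e \<in> E. u \<in> e}"

text \<open>A cycle is represented by the list of its vertices, without repeating the first one at the
  end, so that the length of the list is the length of the cycle.\<close>

definition is_cycle :: "'a set set \<Rightarrow> 'a list \<Rightarrow> bool" where
  "is_cycle E c \<longleftrightarrow> length c \<ge> 3 \<and> distinct c \<and>
     (\<forall>i < length c. {c ! i, c ! ((i + 1) mod length c)} \<in> E)"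

definition contains_cycle :: "'a set set \<Rightarrow> bool" where
  "contains_cycle E \<longleftrightarrow> (\<exists>c. is_cycle E c)"

text \<open>Meaningful only if the graph contains a cycle.\<close>

definition girth :: "'a set set \<Rightarrow> nat" where
  "girth E = (LEAST n. \<exists>c. is_cycle E c \<and> length c = n)"

text \<open>A labeling lives on the disjoint sum \<open>V <+> E\<close>: the label of a vertex \<open>u\<close> is \<open>f (Inl u)\<close>
  and the label of an edge \<open>{u, v}\<close> is \<open>f (Inr {u, v})\<close>.\<close>

definition has_constant_sum :: "'a set set \<Rightarrow> ('a + 'a set \<Rightarrow> nat) \<Rightarrow> nat \<Rightarrow> bool" where
  "has_constant_sum E f k \<longleftrightarrow>
     (\<forall>u v. {u, v} \<in> E \<longrightarrow> f (Inl u) + f (Inl v) + f (Inr {u, v}) = k)"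

definition edge_magic_labeling :: "'a set \<Rightarrow> 'a set set \<Rightarrow> ('a + 'a set \<Rightarrow> nat) \<Rightarrow> bool" where
  "edge_magic_labeling V E f \<longleftrightarrow>
     bij_betw f (V <+> E) {1..card V + card E} \<and> (\<exists>k. has_constant_sum E f k)"

text \<open>The constant is unique as soon as the graph has an edge.\<close>

definition valence :: "'a set set \<Rightarrow> ('a + 'a set \<Rightarrow> nat) \<Rightarrow> nat" where
  "valence E f = (THE k. has_constant_sum E f k)"

definition super_edge_magic_labeling :: "'a set \<Rightarrow> 'a set set \<Rightarrow> ('a + 'a set \<Rightarrow> nat) \<Rightarrow> bool" where
  "super_edge_magic_labeling V E f \<longleftrightarrow>
     edge_magic_labeling V E f \<and> f ` (Inl ` V) = {1..card V}"

definition super_edge_magic :: "'a set \<Rightarrow> 'a set set \<Rightarrow> bool" where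
  "super_edge_magic V E \<longleftrightarrow> (\<exists>f. super_edge_magic_labeling V E f)"

definition valence_averages :: "'a set \<Rightarrow> 'a set set \<Rightarrow> real set" where
  "valence_averages V E =
     {((\<Sum>u\<in>V. real (degree E u) * real (g u)) + (\<Sum>i = card V + 1..card V + card E. real i))
        / real (card E)
      | g. bij_betw g V {1..card V}}"

text \<open>The next two lemmas justify the use of \<open>Min\<close> and \<open>Max\<close> below.\<close>

lemma finite_valence_averages:
  assumes "finite V"
  shows "finite (valence_averages V E)"
proof -
  define F where "F g = ((\<Sum>u\<in>V. real (degree E u) * real (g u))
    + (\<Sum>i = card V + 1..card V + card E. real i)) / real (card E)" for g :: "'a \<Rightarrow> nat"
  have "valence_averages V E \<subseteq>
      F ` {g. \<forall>u. (u \<in> V \<longrightarrow> g u \<in> {1..card V}) \<and> (u \<notin> V \<longrightarrow> g u = 0)}"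
  proof
    fix x assume "x \<in> valence_averages V E"
    then obtain g where g: "bij_betw g V {1..card V}" "x = F g"
      unfolding valence_averages_def F_def by blast
    let ?h = "\<lambda>u. if u \<in> V then g u else 0"
    have "F ?h = F g"
      unfolding F_def by (simp cong: sum.cong)
    moreover have "\<forall>u. (u \<in> V \<longrightarrow> ?h u \<in> {1..card V}) \<and> (u \<notin> V \<longrightarrow> ?h u = 0)"
      using bij_betwE[OF g(1)] by simp
    ultimately show "x \<in> F ` {g. \<forall>u. (u \<in> V \<longrightarrow> g u \<in> {1..card V}) \<and> (u \<notin> V \<longrightarrow> g u = 0)}"
      using g(2) by (intro image_eqI[of _ _ ?h]) simp_all
  qed
  moreover have "finite {g. \<forall>u. (u \<in> V \<longrightarrow> g u \<in> {1..card V}) \<and> (u \<notin> V \<longrightarrow> g u = (0::nat))}"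
    using assms by (intro finite_set_of_finite_funs) simp_all
  ultimately show ?thesis
    using finite_subset by blast
qed

lemma valence_averages_nonempty:
  assumes "finite V"
  shows "valence_averages V E \<noteq> {}"
proof -
  obtain g where "bij_betw g V {1..card V}"
    using finite_same_card_bij[of V "{1..card V}"] assms by auto
  then show ?thesis
    unfolding valence_averages_def by blast
qed

text \<open>The interval is empty if the rounded minimum exceeds the rounded maximum.\<close>

definition super_edge_magic_interval :: "'a set \<Rightarrow> 'a set set \<Rightarrow> int set" where
  "super_edge_magic_interval V E =
     {\<lceil>Min (valence_averages V E)\<rceil>..\<lfloor>Max (valence_averages V E)\<rfloor>}"

definition super_edge_magic_set :: "'a set \<Rightarrow> 'a set set \<Rightarrow> int set" where
  "super_edge_magic_set V E =
     {k \<in> super_edge_magic_interval V E.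
        \<exists>f. super_edge_magic_labeling V E f \<and> int (valence E f) = k}"

end

theory Submission
  imports Defs
begin

text \<open>Let \<open>p\<close> be the order of the graph. In a super edge-magic labeling the sums of the end labels
  of the edges are \<open>2p - 5\<close> consecutive integers between \<open>3\<close> and \<open>2p - 1\<close>, so there are only three
  candidates for the valence: \<open>3p - 2\<close>, \<open>3p - 1\<close> and \<open>3p\<close>. In the first case the sums start at \<open>3\<close>.
  As there are no triangles, the sums \<open>3, 4, \<dots>, p + 1\<close> can only be realised by joining the vertex
  labeled \<open>1\<close> to all the others, and then the sum \<open>p + 2\<close> forces a triangle. Replacing each vertex
  label \<open>i\<close> by \<open>p + 1 - i\<close> reduces the third case to the first. Hence every valence is \<open>3p - 1\<close>.\<close>

section \<open>Cycles, well-defined valences and complementary labels\<close>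

lemma is_cycle_triangle:
  assumes "{u, v} \<in> E" "{v, w} \<in> E" "{w, u} \<in> E" "distinct [u, v, w]"
  shows "is_cycle E [u, v, w]"
proof -
  have "{[u, v, w] ! i, [u, v, w] ! ((i + 1) mod 3)} \<in> E" if "i < 3" for i
  proof -
    have "i = 0 \<or> i = 1 \<or> i = 2"
      using that by linarith
    then show ?thesis
      using assms by (auto simp: nth_Cons')
  qed
  then show ?thesis
    using assms(4) unfolding is_cycle_def by simp
qed

lemma girth_le_length:
  assumes "is_cycle E c"
  shows "girth E \<le> length c"
  unfolding girth_def using assms by (intro Least_le) blast

text \<open>One edge pins the constant down, so the \<open>THE\<close> in \<open>valence\<close>
  denotes it; in a graph without edges every number would qualify.\<close>

lemma edge_magic_labeling_valence:
  assumes "edge_magic_labeling V E f" "{u, v} \<in> E"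
  shows "has_constant_sum E f (valence E f)"
proof -
  obtain k where k: "has_constant_sum E f k"
    using assms(1) unfolding edge_magic_labeling_def by blast
  have "valence E f = k"
    unfolding valence_def
    by (rule the_equality) (use k assms(2) in \<open>auto simp: has_constant_sum_def\<close>)
  then show ?thesis
    using k by simp
qed

lemma bij_betw_complement_label:
  assumes "bij_betw g V {1..p::nat}"
  shows "bij_betw (\<lambda>u. p + 1 - g u) V {1..p}"
proof -
  have "bij_betw (\<lambda>i. p + 1 - i) {1..p} {1..p}"
    by (rule bij_betw_byWitness[where f' = "\<lambda>i. p + 1 - i"]) auto
  from bij_betw_trans[OF assms this] show ?thesis
    by (simp add: comp_def)
qed

section \<open>Girth, order and triangles\<close>

context finite_simple_graph
begin

lemma finite_E: "finite E"
  using finite_V edges by (meson Pow_iff finite_Pow_iff finite_subset subsetI)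

lemma edge_cases:
  assumes "e \<in> E"
  obtains u v where "e = {u, v}" "u \<noteq> v" "u \<in> V" "v \<in> V"
  using edges[OF assms] by (auto simp: card_2_iff)

lemma cycle_set_subset:
  assumes "is_cycle E c"
  shows "set c \<subseteq> V"
proof
  fix x assume "x \<in> set c"
  then obtain i where "i < length c" "c ! i = x"
    by (auto simp: in_set_conv_nth)
  then show "x \<in> V"
    using assms edges unfolding is_cycle_def by blast
qed

text \<open>Turns the girth hypothesis into p \<ge> 5, the bound on which all later estimates
  rest.\<close>

lemma girth_le_card:
  assumes "contains_cycle E"
  shows "girth E \<le> card V"
proof -
  obtain c where c: "is_cycle E c"
    using assms unfolding contains_cycle_def by blast
  then have "length c = card (set c)"
    by (simp add: is_cycle_def distinct_card)
  also have "\<dots> \<le> card V"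
    using cycle_set_subset[OF c] finite_V card_mono by blast
  finally show ?thesis
    using girth_le_length[OF c] by linarith
qed

lemma no_triangle:
  assumes "girth E > 3" "{u, v} \<in> E" "{w, u} \<in> E" "{w, v} \<in> E"
  shows False
proof -
  have "distinct [u, v, w]"
    using assms(2-4) edges[of "{u, v}"] edges[of "{w, u}"] edges[of "{w, v}"]
    by (auto simp: card_insert_if split: if_splits)
  then have "is_cycle E [u, v, w]"
    using assms by (intro is_cycle_triangle) (simp_all add: insert_commute)
  from girth_le_length[OF this] show False
    using assms(1) by simp
qed

section \<open>Small edge sums force a triangle\<close>

text \<open>Stated for an arbitrary numbering \<open>g\<close>, so that it serves both the vertex
  labels and their complements.\<close>

lemma not_all_small_sums:
  assumes girth: "girth E > 3"
    and "V \<noteq> {}"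
    and g: "bij_betw g V {1..card V}"
    and sums: "{3..card V + 2} \<subseteq> (\<lambda>e. \<Sum>u\<in>e. g u) ` E"
  shows False
proof -
  have range: "1 \<le> g u \<and> g u \<le> card V" if "u \<in> V" for u
    using bij_betwE[OF g] that by auto
  have inj: "u = v" if "g u = g v" "u \<in> V" "v \<in> V" for u v
    using bij_betw_imp_inj_on[OF g] that by (auto dest: inj_onD)
  have sum_edge: "\<exists>u v. {u, v} \<in> E \<and> u \<in> V \<and> v \<in> V \<and> g u + g v = s"
    if "3 \<le> s" "s \<le> card V + 2" for s
  proof -
    from sums that obtain e where "e \<in> E" "(\<Sum>u\<in>e. g u) = s"
      by fastforce
    moreover from \<open>e \<in> E\<close> obtain u v where "e = {u, v}" "u \<noteq> v" "u \<in> V" "v \<in> V"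
      by (rule edge_cases)
    ultimately show ?thesis
      by auto
  qed
  have "card V \<ge> 1"
    using finite_V \<open>V \<noteq> {}\<close> by (simp add: Suc_le_eq card_gt_0_iff)
  then obtain w where w: "w \<in> V" "g w = 1"
    using bij_betw_imp_surj_on[OF g] by (metis atLeastAtMost_iff imageE order_refl)
  \<comment> \<open>Strong induction on the label of \<open>v\<close>. If an edge
    \<open>{a, b}\<close> with sum \<open>g v + 1\<close> avoids \<open>w\<close>, both its labels
    lie between 2 and \<open>g v - 1\<close>, so \<open>w\<close> is already joined to both
    ends.\<close>
  have star: "{w, v} \<in> E" if "v \<in> V" "g v \<ge> 2" for v
    using that
  proof (induction "g v" arbitrary: v rule: less_induct)
    case less
    obtain a b where ab: "{a, b} \<in> E" "a \<in> V" "b \<in> V" "g a + g b = g v + 1"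
      using sum_edge[of "g v + 1"] less.prems range[of v] by auto
    consider "g a = 1" | "g b = 1" | "g a \<ge> 2" "g b \<ge> 2"
      using range[of a] range[of b] ab by linarith
    then show ?case
    proof cases
      case 1
      then have "a = w" "b = v"
        using inj w ab less.prems by auto
      then show ?thesis
        using ab by simp
    next
      case 2
      then have "b = w" "a = v"
        using inj w ab less.prems by auto
      then show ?thesis
        using ab by (simp add: insert_commute)
    next
      case 3
      then have "{w, a} \<in> E" "{w, b} \<in> E"
        using less.hyps[of a] less.hyps[of b] ab by auto
      then show ?thesis
        using no_triangle[OF girth ab(1)] by blast
    qed
  qed
  \<comment> \<open>The first sum that label 1 cannot take part in: its partner would need label p +
    1.\<close>
  obtain a b where ab: "{a, b} \<in> E" "a \<in> V" "b \<in> V" "g a + g b = card V + 2"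
    using sum_edge[of "card V + 2"] \<open>card V \<ge> 1\<close> by auto
  then have "g a \<ge> 2" "g b \<ge> 2"
    using range[of a] range[of b] by linarith+
  then show False
    using no_triangle[OF girth ab(1)] star ab by blast
qed

section \<open>Valences lie in the super edge-magic interval\<close>

text \<open>Double counting of incidences, a weighted handshake lemma.\<close>

lemma sum_degree_mult:
  "(\<Sum>u\<in>V. degree E u * g u) = (\<Sum>e\<in>E. \<Sum>u\<in>e. g u)"
proof -
  have "(\<Sum>u\<in>V. degree E u * g u) = (\<Sum>u\<in>V. \<Sum>e | e \<in> E \<and> u \<in> e. g u)"
    by (simp add: degree_def)
  also have "\<dots> = (\<Sum>e\<in>E. \<Sum>u | u \<in> V \<and> u \<in> e. g u)"
    using finite_V finite_E by (rule sum.swap_restrict)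
  also have "\<dots> = (\<Sum>e\<in>E. \<Sum>u\<in>e. g u)"
    by (intro sum.cong refl) (use edges in auto)
  finally show ?thesis .
qed

lemma labeling_edge_sum:
  assumes "edge_magic_labeling V E f" "e \<in> E"
  shows "(\<Sum>u\<in>e. f (Inl u)) + f (Inr e) = valence E f"
proof -
  obtain u v where "e = {u, v}" "u \<noteq> v"
    using edge_cases[OF assms(2)] by metis
  then show ?thesis
    using edge_magic_labeling_valence[OF assms(1), of u v] assms(2)
    by (simp add: has_constant_sum_def)
qed

lemma super_labeling_vertices:
  assumes "super_edge_magic_labeling V E f"
  shows "bij_betw (\<lambda>u. f (Inl u)) V {1..card V}"
  using assms
  unfolding super_edge_magic_labeling_def edge_magic_labeling_def bij_betw_def inj_on_def
  by (auto simp: image_image)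

text \<open>The vertices use up the labels 1 to p, so by injectivity the edges share exactly the
  rest.\<close>

lemma super_labeling_edges:
  assumes "super_edge_magic_labeling V E f"
  shows "bij_betw (\<lambda>e. f (Inr e)) E {card V + 1..card V + card E}"
proof -
  have f: "bij_betw f (V <+> E) {1..card V + card E}" "f ` Inl ` V = {1..card V}"
    using assms unfolding super_edge_magic_labeling_def edge_magic_labeling_def by blast+
  have inj: "inj_on f (V <+> E)"
    using f(1) by (rule bij_betw_imp_inj_on)
  have "f ` Inr ` E = f ` ((V <+> E) - Inl ` V)"
    by (rule arg_cong[where f = "image f"]) auto
  also have "\<dots> = f ` (V <+> E) - f ` Inl ` V"
    by (rule inj_on_image_set_diff[OF inj]) auto
  also have "\<dots> = {card V + 1..card V + card E}"
    using f(2) bij_betw_imp_surj_on[OF f(1)] by auto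
  finally show ?thesis
    using inj unfolding bij_betw_def inj_on_def by (auto simp: image_image)
qed

text \<open>Summing the magic equation over all q edges gives q times the valence; dividing by q
  yields the average that belongs to the vertex labels.\<close>

lemma valence_in_averages:
  assumes f: "super_edge_magic_labeling V E f" and "E \<noteq> {}"
  shows "real (valence E f) \<in> valence_averages V E"
proof -
  define g where "g = (\<lambda>u. f (Inl u))"
  have em: "edge_magic_labeling V E f"
    using f unfolding super_edge_magic_labeling_def by blast
  have "(\<Sum>u\<in>V. degree E u * g u) + (\<Sum>i = card V + 1..card V + card E. i)
      = (\<Sum>e\<in>E. (\<Sum>u\<in>e. g u) + f (Inr e))"
    using sum.reindex_bij_betw[OF super_labeling_edges[OF f], of "\<lambda>i. i"]
    by (simp add: sum_degree_mult sum.distrib)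
  also have "\<dots> = card E * valence E f"
    using labeling_edge_sum[OF em] by (simp add: g_def)
  finally have "real (\<Sum>u\<in>V. degree E u * g u) + real (\<Sum>i = card V + 1..card V + card E. i)
      = real (card E) * real (valence E f)"
    by (metis of_nat_add of_nat_mult)
  moreover have "card E \<noteq> 0"
    using finite_E assms(2) by simp
  ultimately have "real (valence E f) = ((\<Sum>u\<in>V. real (degree E u) * real (g u))
      + (\<Sum>i = card V + 1..card V + card E. real i)) / real (card E)"
    by (simp add: field_simps)
  moreover have "bij_betw g V {1..card V}"
    using super_labeling_vertices[OF f] by (simp add: g_def)
  ultimately show ?thesis
    unfolding valence_averages_def by blast
qed

text \<open>A valence is an integer, so rounding the extreme averages inwards cannot exclude
  it.\<close>

lemma valence_in_super_edge_magic_set: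
  assumes f: "super_edge_magic_labeling V E f" and "E \<noteq> {}"
  shows "int (valence E f) \<in> super_edge_magic_set V E"
proof -
  note fin = finite_valence_averages[OF finite_V, of E]
  note val = valence_in_averages[OF assms]
  have "\<lceil>Min (valence_averages V E)\<rceil> \<le> int (valence E f)"
    using Min_le[OF fin val] by (simp add: ceiling_le_iff)
  moreover have "int (valence E f) \<le> \<lfloor>Max (valence_averages V E)\<rfloor>"
    using Max_ge[OF fin val] by (simp add: le_floor_iff)
  ultimately show ?thesis
    using f unfolding super_edge_magic_set_def super_edge_magic_interval_def by auto
qed

section \<open>Excluding two of the three candidate valences\<close>

lemma super_edge_magic_valence:
  assumes f: "super_edge_magic_labeling V E f"
    and cE: "card E + 5 = 2 * card V" and cV: "card V \<ge> 5" and girth: "girth E > 3"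
  shows "valence E f = 3 * card V - 1"
proof -
  define p k g where "p = card V" and "k = valence E f" and "g = (\<lambda>u. f (Inl u))"
  let ?s = "\<lambda>e. \<Sum>u\<in>e. g u"
  have em: "edge_magic_labeling V E f"
    using f unfolding super_edge_magic_labeling_def by blast
  have g: "bij_betw g V {1..p}"
    using super_labeling_vertices[OF f] by (simp add: g_def p_def)
  have k: "?s e + f (Inr e) = k" if "e \<in> E" for e
    using labeling_edge_sum[OF em that] by (simp add: g_def k_def)
  \<comment> \<open>The largest label is p + q = 3p - 5; the bound is written without subtraction on
    naturals.\<close>
  have edge_label: "\<exists>e\<in>E. f (Inr e) = l" if "p + 1 \<le> l" "l + 5 \<le> 3 * p" for l
  proof -
    have "l \<in> (\<lambda>e. f (Inr e)) ` E"
      using that cE unfolding bij_betw_imp_surj_on[OF super_labeling_edges[OF f]] p_def by simp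
    then show ?thesis
      by auto
  qed
  have sum_bounds: "3 \<le> ?s e \<and> ?s e + 1 \<le> 2 * p" if "e \<in> E" for e
  proof -
    obtain u v where uv: "e = {u, v}" "u \<noteq> v" "u \<in> V" "v \<in> V"
      using \<open>e \<in> E\<close> by (rule edge_cases)
    then have "g u \<noteq> g v"
      using bij_betw_imp_inj_on[OF g] by (auto dest: inj_onD)
    moreover have "1 \<le> g u \<and> g u \<le> p" "1 \<le> g v \<and> g v \<le> p"
      using bij_betwE[OF g] uv by auto
    ultimately show ?thesis
      using uv by simp
  qed
  have p: "p \<ge> 5"
    using cV by (simp add: p_def)
  have ne: "V \<noteq> {}"
    using cV by auto
  \<comment> \<open>The smallest edge label goes with the largest sum k - p - 1, which is at most 2p
    - 1.\<close>
  obtain e1 where "e1 \<in> E" "f (Inr e1) = p + 1"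
    using edge_label[of "p + 1"] p by auto
  then have upper: "k \<le> 3 * p"
    using k[of e1] sum_bounds[of e1] by linarith
  \<comment> \<open>The largest edge label goes with the smallest sum k - 3p + 5, which is at least
    3.\<close>
  obtain e2 where "e2 \<in> E" "f (Inr e2) = 3 * p - 5"
    using edge_label[of "3 * p - 5"] p by fastforce
  then have lower: "3 * p \<le> k + 2"
    using k[of e2] sum_bounds[of e2] p by linarith
  have "k + 2 \<noteq> 3 * p"
  proof
    assume low: "k + 2 = 3 * p"
    \<comment> \<open>The sum s sits on the edge labeled k - s. These labels run from 3p - 5 down to
      2p - 4, which is at least p + 1 because p \<ge> 5.\<close>
    have *: "{3..card V + 2} \<subseteq> ?s ` E"
    proof
      fix s assume s: "s \<in> {3..card V + 2}"
      then have "p + 1 \<le> k - s" "k - s + 5 \<le> 3 * p"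
        using low p unfolding p_def by auto
      then obtain e where "e \<in> E" "f (Inr e) = k - s"
        using edge_label by blast
      then show "s \<in> ?s ` E"
        using k[of e] s low p by (intro image_eqI[of _ _ e]) (auto simp: p_def)
    qed
    then show False
      using not_all_small_sums[OF girth ne _ *] g by (simp add: p_def)
  qed
  moreover have "k \<noteq> 3 * p"
  proof
    assume high: "k = 3 * p"
    define h where "h u = p + 1 - g u" for u
    have h: "bij_betw h V {1..p}"
      unfolding h_def by (rule bij_betw_complement_label[OF g])
    have hs: "(\<Sum>u\<in>e. h u) + ?s e = 2 * p + 2" if "e \<in> E" for e
    proof -
      obtain u v where uv: "e = {u, v}" "u \<noteq> v" "u \<in> V" "v \<in> V"
        using \<open>e \<in> E\<close> by (rule edge_cases)
      moreover have "g u \<le> p" "g v \<le> p"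
        using bij_betwE[OF g] uv by auto
      ultimately show ?thesis
        by (simp add: h_def)
    qed
    \<comment> \<open>A complementary sum s means a sum 2p + 2 - s under \<open>g\<close>, hence the
      edge label p + s - 2. These labels end at 2p, which is at most 3p - 5 because p \<ge>
      5.\<close>
    have *: "{3..card V + 2} \<subseteq> (\<lambda>e. \<Sum>u\<in>e. h u) ` E"
    proof
      fix s assume s: "s \<in> {3..card V + 2}"
      then have "p + 1 \<le> p + s - 2" "p + s - 2 + 5 \<le> 3 * p"
        using p unfolding p_def by auto
      then obtain e where "e \<in> E" "f (Inr e) = p + s - 2"
        using edge_label by blast
      then show "s \<in> (\<lambda>e. \<Sum>u\<in>e. h u) ` E"
        using k[of e] hs[of e] s high p by (intro image_eqI[of _ _ e]) (auto simp: p_def)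
    qed
    then show False
      using not_all_small_sums[OF girth ne _ *] h by (simp add: p_def)
  qed
  ultimately show ?thesis
    using upper lower unfolding k_def p_def by linarith
qed

end

theorem theorem2p4:
  fixes V :: "'a set" and E :: "'a set set"
  assumes "finite_simple_graph V E"
    and "super_edge_magic V E"
    and "contains_cycle E"
    and "int (card E) = 2 * int (card V) - 5"
    and "girth E \<ge> 5"
  shows "card (super_edge_magic_set V E) = 1"
proof -
  interpret finite_simple_graph V E by fact
  have cV: "card V \<ge> 5"
    using girth_le_card[OF assms(3)] assms(5) by linarith
  have cE: "card E + 5 = 2 * card V"
    using assms(4) by linarith
  have "E \<noteq> {}"
    using cE cV by auto
  obtain f where f: "super_edge_magic_labeling V E f"
    using assms(2) unfolding super_edge_magic_def by blast
  have val: "valence E h = 3 * card V - 1" if "super_edge_magic_labeling V E h" for h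
    using super_edge_magic_valence[OF that cE cV] assms(5) by simp
  have "super_edge_magic_set V E = {int (3 * card V - 1)}"
  proof
    show "super_edge_magic_set V E \<subseteq> {int (3 * card V - 1)}"
      using val unfolding super_edge_magic_set_def by auto
    show "{int (3 * card V - 1)} \<subseteq> super_edge_magic_set V E"
      using valence_in_super_edge_magic_set[OF f \<open>E \<noteq> {}\<close>] val[OF f] by simp
  qed
  then show ?thesis
    by simp
qed

end
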